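(* Let $G$ be a connected split graph with at least one edge, with a fixed partition $V(G)=C\sqcup I$ where $C$ induces a clique and $I$ is an independent set. Let $m=|I|$ and $\Delta_I=\max\{|N_G(c)\cap I| : c\in C\}$. Then $$M(G)=m-\Delta_I.$$
   Context: A split graph is a graph whose vertex set admits a partition $C\sqcup I$ with $C$ inducing a clique and $I$ inducing an independent set; $N_G(c)$ is the set of neighbors of $c$. The independence polynomial is $P_G(x)=\sum_{j\ge0}g_jx^j\in\mathbb{Z}[x]$, where $g_j$ is the number of independent sets of $G$ of size $j$, and $M(G)$ is the multiplicity of $-1$ as a root of $P_G(x)$ over $\mathbb{Q}$ ($0$ if $P_G(-1)\neq0$). *)

theory Defs
  imports "HOL-Computational_Algebra.Polynomial" "Graph_Theory.Graph_Theory"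
begin

text \<open>
  Finite simple graphs are the locale \<^locale>\<open>graph\<close>: finite, loop-free, symmetric digraphs
  without parallel arcs. An undirected edge \<open>uv\<close> is the pair of arcs from \<open>u\<close> to \<open>v\<close> and
  from \<open>v\<close> to \<open>u\<close>, so \<open>u \<rightarrow>\<^bsub>G\<^esub> v\<close> is adjacency.
\<close>

definition nbrs :: "('a, 'b) pre_digraph \<Rightarrow> 'a \<Rightarrow> 'a set" where
  "nbrs G v = {u \<in> verts G. v \<rightarrow>\<^bsub>G\<^esub> u}"

definition clique :: "('a, 'b) pre_digraph \<Rightarrow> 'a set \<Rightarrow> bool" where
  "clique G S \<longleftrightarrow> S \<subseteq> verts G \<and> (\<forall>u\<in>S. \<forall>v\<in>S. u \<noteq> v \<longrightarrow> u \<rightarrow>\<^bsub>G\<^esub> v)"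

definition independent_set :: "('a, 'b) pre_digraph \<Rightarrow> 'a set \<Rightarrow> bool" where
  "independent_set G S \<longleftrightarrow> S \<subseteq> verts G \<and> (\<forall>u\<in>S. \<forall>v\<in>S. \<not> u \<rightarrow>\<^bsub>G\<^esub> v)"

text \<open>Either part of a split partition may be empty.\<close>

definition split_partition :: "('a, 'b) pre_digraph \<Rightarrow> 'a set \<Rightarrow> 'a set \<Rightarrow> bool" where
  "split_partition G C I \<longleftrightarrow>
     verts G = C \<union> I \<and> C \<inter> I = {} \<and> clique G C \<and> independent_set G I"

definition num_independent_sets :: "('a, 'b) pre_digraph \<Rightarrow> nat \<Rightarrow> nat" where
  "num_independent_sets G j = card {S. independent_set G S \<and> card S = j}"

text \<open>
  The sum over all \<open>j \<ge> 0\<close> stops at the number of vertices, beyond which a finite graph has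
  no independent sets.
\<close>

definition independence_poly :: "('a, 'b) pre_digraph \<Rightarrow> int poly" where
  "independence_poly G = (\<Sum>j\<le>card (verts G). monom (int (num_independent_sets G j)) j)"

text \<open>
  \<^const>\<open>order\<close> is \<open>0\<close> at a non-root. It is unspecified for the zero polynomial, but
  the independence polynomial of a finite graph has constant coefficient \<open>1\<close>.
\<close>

definition mult_neg_one :: "('a, 'b) pre_digraph \<Rightarrow> nat" where
  "mult_neg_one G = order (- 1) (map_poly rat_of_int (independence_poly G))"

end

theory Submission
  imports Defs
begin

text \<open>
  An independent set of a split graph contains at most one vertex of the clique. Those avoiding
  the clique are the subsets of \<open>I\<close>; those through \<open>c \<in> C\<close> consist of \<open>c\<close> and a subset of \<open>I\<close>
  minus the \<open>d\<^sub>c\<close> neighbours of \<open>c\<close>. Since the subsets of an \<open>n\<close>-set contribute \<open>(1 + x)\<^sup>n\<close>,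
  \[ P_G(x) = (1 + x)^m + x \sum_{c \in C} (1 + x)^{m - d_c}. \]
  With \<open>D\<close> the largest \<open>d\<^sub>c\<close>, the factor \<open>(1 + x)\<^bsup>m - D\<^esup>\<close> splits off, and the cofactor
  \[ (1 + x)^D + x \sum_{c \in C} (1 + x)^{D - d_c} \]
  has at \<open>-1\<close> the value \<open>[D = 0] - k\<close>, where \<open>k\<close> is the number of \<open>c\<close> with \<open>d\<^sub>c = D\<close>. That is
  nonzero. If \<open>D > 0\<close>, this is because the maximum is attained. If \<open>D = 0\<close>, no edge joins \<open>C\<close> to
  \<open>I\<close>, so the edge that the graph has lies in \<open>C\<close>, whence \<open>k = |C| \<ge> 2\<close>.
\<close>

lemma sum_Pow_monom_card:
  assumes "finite A"
  shows "(\<Sum>S\<in>Pow A. monom (1::'a::comm_ring_1) (card S)) = [:1, 1:] ^ card A"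
proof -
  have "(\<Sum>S\<in>Pow A. monom (1::'a) (card S)) =
      (\<Sum>S\<in>Pow A. (\<Prod>a\<in>S. monom 1 1) * (\<Prod>a\<in>A - S. 1))"
    by (simp add: monom_power)
  also have "\<dots> = (\<Prod>a\<in>A. monom 1 1 + 1)"
    using prod_add[OF assms, of "\<lambda>_. monom (1::'a) 1" "\<lambda>_. 1"] by simp
  also have "\<dots> = [:1, 1:] ^ card A"
    by (simp add: monom_altdef one_pCons)
  finally show ?thesis .
qed

text \<open>
  Summing over the independent sets themselves, rather than over their sizes, lets a partition of
  the family of independent sets split the polynomial directly.
\<close>

lemma independence_poly_eq_sum_independent_sets:
  assumes "finite (verts G)"
  shows "map_poly rat_of_int (independence_poly G) =
    (\<Sum>S | independent_set G S. monom 1 (card S))"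
proof (rule poly_eqI)
  fix j
  have fin: "finite {S. independent_set G S}"
    by (rule finite_subset[of _ "Pow (verts G)"])
      (use assms in \<open>auto simp: independent_set_def\<close>)
  have "{S. independent_set G S \<and> card S = j} = {}" if "j > card (verts G)"
    using that card_mono[OF assms] by (fastforce simp: independent_set_def)
  hence "coeff (independence_poly G) j = int (num_independent_sets G j)"
    by (auto simp: independence_poly_def coeff_sum num_independent_sets_def not_le
        simp del: Collect_empty_eq)
  moreover have "(\<Sum>S | independent_set G S. coeff (monom (1::rat) (card S)) j) =
      of_nat (num_independent_sets G j)"
    using fin by (simp add: num_independent_sets_def sum.If_cases Int_def)
  ultimately show "coeff (map_poly rat_of_int (independence_poly G)) j =
      coeff (\<Sum>S | independent_set G S. monom 1 (card S)) j"
    by (simp add: coeff_map_poly coeff_sum)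
qed

text \<open>
  Two vertices of the clique are adjacent, so an independent set through \<open>c \<in> C\<close> has its other
  vertices in \<open>I\<close>, and outside the neighbourhood of \<open>c\<close>.
\<close>

lemma independent_sets_split:
  assumes "graph G" and split: "split_partition G C I"
  shows "{S. independent_set G S} =
    Pow I \<union> (\<Union>c\<in>C. insert c ` Pow (I - nbrs G c))" (is "?L = ?R")
proof -
  interpret graph G by fact
  have V: "verts G = C \<union> I" and disj: "C \<inter> I = {}"
    and C: "\<And>u v. u \<in> C \<Longrightarrow> v \<in> C \<Longrightarrow> u \<noteq> v \<Longrightarrow> u \<rightarrow>\<^bsub>G\<^esub> v"
    and I: "\<And>u v. u \<in> I \<Longrightarrow> v \<in> I \<Longrightarrow> \<not> u \<rightarrow>\<^bsub>G\<^esub> v"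
    using split by (auto simp: split_partition_def clique_def independent_set_def)
  have "S \<in> ?R" if S: "independent_set G S" for S
  proof (cases "S \<inter> C = {}")
    case True
    thus ?thesis using S V by (auto simp: independent_set_def)
  next
    case False
    then obtain c where c: "c \<in> S" "c \<in> C" by auto
    have "S - {c} \<subseteq> I - nbrs G c"
      using S c V C by (fastforce simp: independent_set_def nbrs_def)
    moreover have "S = insert c (S - {c})" using c by auto
    ultimately show ?thesis using c by blast
  qed
  moreover have "independent_set G S" if "S \<in> Pow I" for S
    using that V I unfolding independent_set_def by blast
  moreover have "independent_set G (insert c T)" if "c \<in> C" "T \<subseteq> I - nbrs G c" for c T
  proof -
    have "\<not> c \<rightarrow>\<^bsub>G\<^esub> c" using adj_not_same by blast
    moreover have "\<not> c \<rightarrow>\<^bsub>G\<^esub> v" "\<not> v \<rightarrow>\<^bsub>G\<^esub> c" if "v \<in> T" for v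
      using that \<open>T \<subseteq> I - nbrs G c\<close> V graph_symmetric by (auto simp: nbrs_def)
    ultimately show ?thesis
      using that V I unfolding independent_set_def by blast
  qed
  ultimately show ?thesis by auto
qed

lemma independence_poly_split:
  assumes "graph G" and split: "split_partition G C I"
  shows "map_poly rat_of_int (independence_poly G) =
    [:1, 1:] ^ card I + (\<Sum>c\<in>C. [:0, 1:] * [:1, 1:] ^ (card I - card (nbrs G c \<inter> I)))"
proof -
  interpret graph G by fact
  have disj: "C \<inter> I = {}" using split by (simp add: split_partition_def)
  have "finite (C \<union> I)" using split finite_verts by (simp add: split_partition_def)
  hence fin: "finite C" "finite I" by auto
  let ?w = "\<lambda>S. monom (1::rat) (card S)"
  let ?A = "\<lambda>c. insert c ` Pow (I - nbrs G c)"
  have through: "sum ?w (?A c) = [:0, 1:] * [:1, 1:] ^ (card I - card (nbrs G c \<inter> I))"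
    if "c \<in> C" for c
  proof -
    have c: "c \<notin> I" using that disj by auto
    have "sum ?w (?A c) = (\<Sum>T\<in>Pow (I - nbrs G c). ?w (insert c T))"
      by (rule sum.reindex_cong[of "insert c"]) (use c in \<open>auto intro!: inj_onI\<close>)
    also have "\<dots> = (\<Sum>T\<in>Pow (I - nbrs G c). [:0, 1:] * ?w T)"
    proof (rule sum.cong[OF refl])
      fix T assume "T \<in> Pow (I - nbrs G c)"
      moreover from this have "finite T" using fin(2) finite_subset by blast
      ultimately show "?w (insert c T) = [:0, 1:] * ?w T"
        using c by (subst card_insert_disjoint) (auto simp: monom_Suc)
    qed
    also have "\<dots> = [:0, 1:] * [:1, 1:] ^ card (I - nbrs G c)"
      using fin(2) by (simp add: sum_distrib_left[symmetric] sum_Pow_monom_card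
          del: mult_pCons_left)
    also have "card (I - nbrs G c) = card I - card (nbrs G c \<inter> I)"
      using fin(2) by (simp add: card_Diff_subset_Int Int_commute)
    finally show ?thesis .
  qed
  have "map_poly rat_of_int (independence_poly G) = sum ?w (Pow I \<union> (\<Union>c\<in>C. ?A c))"
    by (simp add: independence_poly_eq_sum_independent_sets
        independent_sets_split[OF assms])
  also have "\<dots> = sum ?w (Pow I) + sum ?w (\<Union>c\<in>C. ?A c)"
    by (rule sum.union_disjoint) (use fin disj in auto)
  also have "sum ?w (\<Union>c\<in>C. ?A c) = (\<Sum>c\<in>C. sum ?w (?A c))"
    by (rule sum.UNION_disjoint) (use fin disj in \<open>auto 0 4\<close>)
  finally show ?thesis
    using fin by (simp add: sum_Pow_monom_card through)
qed

text \<open>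
  The purely algebraic half of the argument: the polynomial on the left need not come from a graph.
  When the maximum is \<open>0\<close>, the cofactor is \<open>1 + |C| x\<close>, which vanishes at \<open>-1\<close> exactly if \<open>|C| = 1\<close>;
  the last hypothesis rules this out.
\<close>

lemma order_neg_one_sum_powers:
  fixes d :: "'c \<Rightarrow> nat"
  assumes fin: "finite C" and "C \<noteq> {}" and "Max (d ` C) \<le> m"
    and "Max (d ` C) = 0 \<Longrightarrow> card C \<noteq> 1"
  shows "order (- 1) ([:1, 1:] ^ m + (\<Sum>c\<in>C. [:0, 1:] * [:1, 1:] ^ (m - d c)) :: rat poly)
    = m - Max (d ` C)"
proof -
  define D where "D = Max (d ` C)"
  define k where "k = card {c \<in> C. d c = D}"
  define q :: "rat poly" where
    "q = [:1, 1:] ^ D + (\<Sum>c\<in>C. [:0, 1:] * [:1, 1:] ^ (D - d c))"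
  have le: "d c \<le> D" if "c \<in> C" for c
    using that fin by (simp add: D_def)
  have "D \<in> d ` C" using fin \<open>C \<noteq> {}\<close> by (auto simp: D_def)
  hence k: "k > 0" using fin by (auto simp: k_def card_gt_0_iff)
  have "poly q (- 1) = (if D = 0 then 1 else 0) - (\<Sum>c\<in>C. if d c = D then 1 else 0)"
    by (auto simp: q_def poly_sum power_0_left sum_negf[symmetric] dest: le intro!: sum.cong)
  also have "(\<Sum>c\<in>C. if d c = D then 1 else 0) = rat_of_nat k"
    using fin by (simp add: k_def sum.If_cases Int_def)
  finally have val: "poly q (- 1) = (if D = 0 then 1 else 0) - rat_of_nat k" .
  have "{c \<in> C. d c = D} = C" if "D = 0" using that le by auto
  hence "k \<noteq> 1" if "D = 0" using that assms(4) by (simp add: k_def D_def)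
  hence nz: "poly q (- 1) \<noteq> 0" using val k by (cases "D = 0") auto
  have split: "[:1, 1:] ^ (m - D) * [:1, 1:] ^ (D - i) = ([:1, 1:] :: rat poly) ^ (m - i)"
    if "i \<le> D" for i
    using that \<open>Max (d ` C) \<le> m\<close> by (simp add: D_def power_add[symmetric])
  have "[:1, 1:] ^ (m - D) * q =
      [:1, 1:] ^ m + (\<Sum>c\<in>C. [:0, 1:] * [:1, 1:] ^ (m - d c))"
    unfolding q_def distrib_left sum_distrib_left
    using split[of 0] le
    by (auto simp: split mult.left_commute[of _ "[:0, 1:]"] simp del: mult_pCons_left
        intro!: sum.cong)
  moreover have "order (- 1) ([:1, 1:] ^ (m - D) * q) = m - D"
  proof -
    have "order (- 1) ([:1, 1:] ^ (m - D) :: rat poly) = m - D"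
      using order_power_n_n[of "- 1 :: rat" "m - D"] by simp
    moreover have "[:1, 1:] ^ (m - D) * q \<noteq> 0" using nz by auto
    ultimately show ?thesis using nz by (simp add: order_mult order_0I)
  qed
  ultimately show ?thesis by (simp add: D_def)
qed

theorem proposition8p6:
  fixes G :: "('a, 'b) pre_digraph" and C I :: "'a set"
  assumes "graph G"
    and "Digraph_Component.connected G"
    and "arcs G \<noteq> {}"
    and "split_partition G C I"
  shows "int (mult_neg_one G) = int (card I) - int (Max {card (nbrs G c \<inter> I) | c. c \<in> C})"
proof -
  interpret graph G by fact
  have V: "verts G = C \<union> I" and I: "\<And>u v. u \<in> I \<Longrightarrow> v \<in> I \<Longrightarrow> \<not> u \<rightarrow>\<^bsub>G\<^esub> v"
    using assms(4) by (auto simp: split_partition_def independent_set_def)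
  have "finite (C \<union> I)" using V finite_verts by simp
  hence fin: "finite C" "finite I" by auto
  define d where "d c = card (nbrs G c \<inter> I)" for c
  obtain e where "e \<in> arcs G" using assms(3) by auto
  then obtain u v where uv: "u \<rightarrow>\<^bsub>G\<^esub> v" by (meson in_arcs_imp_in_arcs_ends)
  have "\<exists>u v. u \<rightarrow>\<^bsub>G\<^esub> v \<and> u \<in> C"
  proof (cases "u \<in> C")
    case False
    hence "v \<in> C" using uv V I adj_in_verts by blast
    thus ?thesis using uv graph_symmetric by blast
  qed (use uv in blast)
  then obtain u v where uv: "u \<rightarrow>\<^bsub>G\<^esub> v" "u \<in> C" by blast
  have le: "Max (d ` C) \<le> card I"
    using fin uv(2) by (subst Max_le_iff) (auto simp: d_def intro: card_mono)
  have "card C \<noteq> 1" if "Max (d ` C) = 0"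
  proof
    assume "card C = 1"
    hence "v \<notin> C" using uv adj_not_same by (auto simp: card_1_singleton_iff)
    hence "v \<in> nbrs G u \<inter> I" using uv V adj_in_verts(2)[OF uv(1)] by (auto simp: nbrs_def)
    hence "d u > 0" using fin by (auto simp: d_def card_gt_0_iff)
    moreover have "d u \<le> Max (d ` C)" using fin uv(2) by simp
    ultimately show False using that by simp
  qed
  with fin uv(2) le have "mult_neg_one G = card I - Max (d ` C)"
    unfolding mult_neg_one_def independence_poly_split[OF assms(1,4)] d_def[symmetric]
    by (intro order_neg_one_sum_powers) auto
  moreover have "{card (nbrs G c \<inter> I) | c. c \<in> C} = d ` C" by (auto simp: d_def)
  ultimately show ?thesis using le by simp
qed

end
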